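(* Let $\Omega\subset\mathbb{R}$ be connected and let $f\colon\Omega\to\mathbb{R}$ have minimum value $y^*$, attained at $x^*$. Suppose that $f$ is either a coercive strictly convex function, or a function that is strictly convex in a neighborhood of $x^*$; in the latter case it is required to be sufficiently close to the minimum point. If $f$ is strictly convex and coercive, the starting value $y>y^*$ can be arbitrary; otherwise $y$ needs to be sufficiently close to $y^*$. Given $\epsilon>0$, $\delta\in(0,1)$, $\tilde y<y^*$ and $y>y^*$, run the algorithm described in the context. Let $u_n$ be the sequence of upper bounds (the successive values of $y$, for which there exist $x_1,x_2$) and $l_n$ the sequence of lower bounds (the successive values of $\tilde y$). Then $u_n\to y^*$ and $l_n\to y^*$ as $n\to\infty$, and as a consequence the algorithm can find $x_1,x_2$ such that $|x_1-x_2|<\delta$.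
   Context: A function $f$ is coercive if $f(x)\to+\infty$ as $|x|\to\infty$. The algorithm: 1. Given $\epsilon>0$, $\delta>0$ with $\delta\in(0,1)$, $\tilde y<y^*$ and $y>y^*$. 2. Compute $x_1,x_2$ such that $f(x_1)=f(x_2)=y$. 3. Compute $|x_2-x_1|$, where $x^*$ lies in the open interval with endpoints $x_1$ and $x_2$. 4. While $|x_2-x_1|>\delta$: set $\mathrm{temp}=(y+\tilde y)/2$ and compute $x_1,x_2$ such that $f(x_1)=f(x_2)=\mathrm{temp}$. If no such pair $(x_1,x_2)$ exists, set $\tilde y=\mathrm{temp}$; otherwise set $y=\mathrm{temp}$. 5. Return $x_1,x_2$. Thus $u_1=y$ and $l_1=\tilde y$ (the input values), and at each step either $u_{n+1}=u_n$ and $l_{n+1}=(u_n+l_n)/2$, or $u_{n+1}=(u_n+l_n)/2$ and $l_{n+1}=l_n$.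
   Formalization: In the strictly convex coercive case, f is also assumed continuous at endpoints of Ω lying in Ω (the claim fails otherwise); in the local case |x₁−x₂|<δ is claimed when the pairs eventually lie in the neighbourhood of x* where f is strictly convex. *)

theory Defs
  imports "HOL-Analysis.Analysis"
begin

text \<open>A function \<open>f : \<Omega> \<rightarrow> \<real>\<close> is a total \<open>real \<Rightarrow> real\<close>, of which only the values on \<open>\<Omega>\<close> are used.\<close>

definition strictly_convex_on :: "real set \<Rightarrow> (real \<Rightarrow> real) \<Rightarrow> bool" where
  "strictly_convex_on S f \<longleftrightarrow> convex S \<and>
     (\<forall>x\<in>S. \<forall>y\<in>S. \<forall>t. x \<noteq> y \<and> 0 < t \<and> t < 1 \<longrightarrow>
        f ((1 - t) * x + t * y) < (1 - t) * f x + t * f y)"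

text \<open>\<open>f x \<rightarrow> +\<infinity>\<close> as \<open>\<bar>x\<bar> \<rightarrow> \<infinity>\<close> with \<open>x\<close> ranging over the domain \<open>\<Omega>\<close>; this says nothing when
  \<open>\<Omega>\<close> is bounded.\<close>

definition coercive_on :: "real set \<Rightarrow> (real \<Rightarrow> real) \<Rightarrow> bool" where
  "coercive_on \<Omega> f \<longleftrightarrow> filterlim f at_top (inf at_infinity (principal \<Omega>))"

text \<open>\<open>D\<close> is the set in which the pair is looked for. The two points may come in either order.\<close>

definition level_pair ::
  "real set \<Rightarrow> (real \<Rightarrow> real) \<Rightarrow> real \<Rightarrow> real \<Rightarrow> real \<Rightarrow> real \<Rightarrow> bool" where
  "level_pair D f xstar c x1 x2 \<longleftrightarrow>
     x1 \<in> D \<and> x2 \<in> D \<and> f x1 = c \<and> f x2 = c \<and> xstar \<in> open_segment x1 x2"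

text \<open>The iterates of the loop body, continued for ever (the stopping test is \<open>loop_exit\<close> below).
  Index \<open>0\<close> is the state on entry to the loop. The pair computed for a level is an arbitrary one,
  so this is a relation; when no pair exists the previous one is kept.\<close>

definition bisection_run ::
  "real set \<Rightarrow> (real \<Rightarrow> real) \<Rightarrow> real \<Rightarrow> real \<Rightarrow> real \<Rightarrow>
   (nat \<Rightarrow> real) \<Rightarrow> (nat \<Rightarrow> real) \<Rightarrow> (nat \<Rightarrow> real) \<Rightarrow> (nat \<Rightarrow> real) \<Rightarrow> bool" where
  "bisection_run D f xstar y ytilde u l x1 x2 \<longleftrightarrow>
     u 0 = y \<and> l 0 = ytilde \<and> level_pair D f xstar y (x1 0) (x2 0) \<and>
     (\<forall>n. let temp = (u n + l n) / 2 in
        if \<exists>a b. level_pair D f xstar temp a b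
        then u (Suc n) = temp \<and> l (Suc n) = l n \<and>
             level_pair D f xstar temp (x1 (Suc n)) (x2 (Suc n))
        else u (Suc n) = u n \<and> l (Suc n) = temp \<and>
             x1 (Suc n) = x1 n \<and> x2 (Suc n) = x2 n)"

text \<open>The while loop stops after exactly \<open>n\<close> passes.\<close>

definition loop_exit :: "real \<Rightarrow> (nat \<Rightarrow> real) \<Rightarrow> (nat \<Rightarrow> real) \<Rightarrow> nat \<Rightarrow> bool" where
  "loop_exit \<delta> x1 x2 n \<longleftrightarrow>
     \<not> \<bar>x2 n - x1 n\<bar> > \<delta> \<and> (\<forall>m<n. \<bar>x2 m - x1 m\<bar> > \<delta>)"

end

(* Strict convexity makes the minimiser unique, and below a level at which a pair exists the
   intermediate value theorem gives a pair at every level above ystar. So the bisection always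
   brackets ystar, and its width halves at each step. The pairs close up because outside a
   neighbourhood of the minimiser a strictly convex function on an interval stays away from its
   minimum; coercivity is needed only to find a first pair. *)

theory Submission
  imports Defs
begin

section \<open>Strict convexity and minima on the line\<close>

lemma strictly_convex_on_imp_convex_on:
  assumes "strictly_convex_on S f"
  shows "convex_on S f"
proof (rule convex_onI)
  show "convex S" using assms by (simp add: strictly_convex_on_def)
  fix t x y :: real
  assume "0 < t" "t < 1" "x \<in> S" "y \<in> S"
  then show "f ((1 - t) *\<^sub>R x + t *\<^sub>R y) \<le> (1 - t) * f x + t * f y"
    using assms by (cases "x = y") (auto simp: strictly_convex_on_def less_imp_le simp flip: distrib_right)
qed

lemma strictly_convex_on_subset:
  assumes "strictly_convex_on S f" "T \<subseteq> S" "convex T"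
  shows "strictly_convex_on T f"
  using assms unfolding strictly_convex_on_def by blast

text \<open>A convex function on an open set is continuous. At an endpoint belonging to
  \<open>S\<close> it may jump upwards, so only the interior is covered.\<close>

lemma strictly_convex_on_continuous_on_interior:
  assumes "strictly_convex_on S f"
  shows "continuous_on (interior S) f"
proof -
  have "convex S" using assms by (simp add: strictly_convex_on_def)
  then have "strictly_convex_on (interior S) f"
    using strictly_convex_on_subset[OF assms interior_subset] convex_interior by blast
  then show ?thesis
    using convex_on_continuous[OF open_interior] strictly_convex_on_imp_convex_on by blast
qed

text \<open>At the midpoint of two distinct minimisers strict convexity would push the value below
  the minimum.\<close>

lemma strictly_convex_on_minimum_unique:
  assumes "strictly_convex_on S f" "m \<in> S" "\<forall>x\<in>S. f m \<le> f x" "x \<in> S" "x \<noteq> m"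
  shows "f m < f x"
proof (rule ccontr)
  assume "\<not> f m < f x"
  then have eq: "f x = f m" using assms by force
  let ?z = "(1 - 1/2) * m + 1/2 * x"
  have "f ?z < (1 - 1/2) * f m + 1/2 * f x"
    using assms unfolding strictly_convex_on_def
    by (smt (verit, best) field_sum_of_halves half_gt_zero_iff)
  moreover have "?z \<in> S"
    using assms convexD_alt[of S m x "1/2"] by (simp add: strictly_convex_on_def)
  ultimately show False using eq assms(3) by fastforce
qed

text \<open>On the segment the graph lies under the chord, whose highest value is at the end
  \<open>p\<close>.\<close>

lemma convex_on_le_between:
  fixes f :: "real \<Rightarrow> real"
  assumes "convex_on S f" "m \<in> S" "p \<in> S" "f m \<le> f p" "q \<in> closed_segment m p"
  shows "q \<in> S" "f q \<le> f p"
proof -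
  obtain t where t: "0 \<le> t" "t \<le> 1" "q = (1 - t) *\<^sub>R m + t *\<^sub>R p"
    using assms(5) by (auto simp: closed_segment_def)
  show "q \<in> S"
    using assms t convexD_alt[OF convex_on_imp_convex[OF assms(1)]] by blast
  have "f q \<le> (1 - t) * f m + t * f p"
    using assms t convex_onD[OF assms(1)] by blast
  also have "\<dots> \<le> (1 - t) * f p + t * f p"
    using assms t by (intro add_mono mult_left_mono) auto
  finally show "f q \<le> f p" by (simp add: algebra_simps)
qed

text \<open>To get from \<open>m\<close> to a point at distance at least \<open>d\<close>, one must
  cross \<open>m - d\<close> or \<open>m + d\<close>. The value there already exceeds
  \<open>f m\<close> by a fixed amount, and beyond it \<open>f\<close> cannot be smaller.\<close>

lemma strictly_convex_on_sublevel_small: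
  assumes "strictly_convex_on S f" "m \<in> S" "\<forall>x\<in>S. f m \<le> f x" "d > 0"
  shows "\<exists>e>0. \<forall>p\<in>S. f p < f m + e \<longrightarrow> \<bar>p - m\<bar> < d"
proof -
  have side: "\<exists>e>0. \<forall>p\<in>S. f p < f m + e \<longrightarrow> q \<notin> closed_segment m p" if "q \<noteq> m" for q
  proof (cases "q \<in> S")
    case True
    then have "f m < f q"
      using strictly_convex_on_minimum_unique assms that by blast
    moreover have "f q \<le> f p" if "p \<in> S" "q \<in> closed_segment m p" for p
      using convex_on_le_between(2)[OF strictly_convex_on_imp_convex_on] assms that by blast
    ultimately show ?thesis
      by (intro exI[of _ "f q - f m"]) force
  next
    case False
    \<comment> \<open>By convexity no segment inside \<open>S\<close> passes through a point outside
      \<open>S\<close>, so any positive \<open>e\<close> serves.\<close>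
    then show ?thesis
      using convex_on_le_between(1)[OF strictly_convex_on_imp_convex_on] assms
      by (intro exI[of _ 1]) (meson zero_less_one)
  qed
  obtain e1 where e1: "e1 > 0" "\<forall>p\<in>S. f p < f m + e1 \<longrightarrow> m - d \<notin> closed_segment m p"
    using side[of "m - d"] assms(4) by auto
  obtain e2 where e2: "e2 > 0" "\<forall>p\<in>S. f p < f m + e2 \<longrightarrow> m + d \<notin> closed_segment m p"
    using side[of "m + d"] assms(4) by auto
  show ?thesis
  proof (intro exI[of _ "min e1 e2"] conjI ballI impI)
    fix p assume "p \<in> S" "f p < f m + min e1 e2"
    then have "m - d \<notin> closed_segment m p" "m + d \<notin> closed_segment m p"
      using e1 e2 by auto
    then show "\<bar>p - m\<bar> < d"
      using assms(4) by (auto simp: closed_segment_eq_real_ivl split: if_splits)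
  qed (use e1 e2 in auto)
qed

section \<open>Pairs of points on a common level\<close>

lemma level_pair_ordered:
  assumes "level_pair D f m c p q"
  obtains a b where "a < m" "m < b" "a \<in> D" "b \<in> D" "f a = c" "f b = c"
  using assms unfolding level_pair_def open_segment_eq_real_ivl
  by (cases "p \<le> q") auto

text \<open>The pair lies strictly on both sides of \<open>m\<close>, and convexity puts the whole
  interval between its points into \<open>S\<close>. Thus the mere existence of a run excludes a
  minimiser at an endpoint.\<close>

lemma level_pair_interior:
  assumes "level_pair D f m c p q" "D \<subseteq> S" "convex S"
  shows "m \<in> interior S"
proof -
  obtain a b where "a < m" "m < b" "a \<in> D" "b \<in> D"
    using level_pair_ordered[OF assms(1)] .
  moreover from this have "{a..b} \<subseteq> S"
    using assms closed_segment_subset[of a S b] by (auto simp: closed_segment_eq_real_ivl1)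
  ultimately show ?thesis
    by (intro interiorI[of "{a<..<b}"]) auto
qed

text \<open>The intermediate value theorem is applied once on each side of \<open>m\<close>.\<close>

lemma level_pair_exists:
  assumes "a < m" "m < b" "continuous_on {a..b} f" "{a..b} \<subseteq> D"
    and "f m < c" "c \<le> f a" "c \<le> f b"
  shows "\<exists>p q. level_pair D f m c p q"
proof -
  have "continuous_on {a..m} f" "continuous_on {m..b} f"
    using assms by (auto intro: continuous_on_subset)
  then obtain p q where "a \<le> p" "p \<le> m" "f p = c" "m \<le> q" "q \<le> b" "f q = c"
    using IVT2'[of f m c a] IVT'[of f m c b] assms by fastforce
  \<comment> \<open>Since \<open>f m < c\<close>, neither point can be \<open>m\<close>
    itself.\<close>
  moreover from this have "p < m" "m < q"
    using assms(5) by (auto simp: order.strict_iff_order)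
  ultimately show ?thesis
    using assms(4)
    by (intro exI[of _ p] exI[of _ q]) (auto simp: level_pair_def open_segment_eq_real_ivl)
qed

section \<open>Runs of the bisection: convergence, existence, termination\<close>

lemma bisection_run_level_pair:
  assumes "bisection_run D f m y yt u l x1 x2"
  shows "level_pair D f m (u n) (x1 n) (x2 n)"
proof (induction n)
  case 0
  then show ?case using assms by (simp add: bisection_run_def)
next
  case (Suc n)
  then show ?case using assms unfolding bisection_run_def Let_def by metis
qed

text \<open>The upper bound is always a value of \<open>f\<close> on \<open>D\<close>, and a level
  without a pair must be at most \<open>ys\<close>. So \<open>ys\<close> stays between the two
  bounds while their distance halves.\<close>

lemma bisection_run_tendsto:
  assumes run: "bisection_run D f m y yt u l x1 x2"
    and min: "\<forall>x\<in>D. ys \<le> f x"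
    and ex: "\<And>c. ys < c \<Longrightarrow> c < y \<Longrightarrow> \<exists>p q. level_pair D f m c p q"
    and "yt < ys"
  shows "u \<longlonglongrightarrow> ys" "l \<longlonglongrightarrow> ys"
proof -
  have step: "if \<exists>a b. level_pair D f m ((u n + l n) / 2) a b
      then u (Suc n) = (u n + l n) / 2 \<and> l (Suc n) = l n
      else u (Suc n) = u n \<and> l (Suc n) = (u n + l n) / 2" for n
    using run unfolding bisection_run_def Let_def by metis
  have u0: "u 0 = y" "l 0 = yt"
    using run by (auto simp: bisection_run_def)
  have lower: "ys \<le> u n" for n
    using bisection_run_level_pair[OF run, of n] min by (auto simp: level_pair_def)
  have upper: "l n \<le> ys \<and> u n \<le> y" for n
  proof (induction n)
    case 0
    then show ?case using u0 assms by simp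
  next
    case (Suc n)
    show ?case
    proof (cases "\<exists>a b. level_pair D f m ((u n + l n) / 2) a b")
      case True
      then show ?thesis using step[of n] Suc lower[of n] by auto
    next
      case False
      have "(u n + l n) / 2 \<le> ys"
      proof (rule ccontr)
        \<comment> \<open>A midpoint above \<open>ys \<ge> l n\<close> lies strictly below
          \<open>u n \<le> y\<close>, hence in the range where \<open>ex\<close> provides a
          pair.\<close>
        assume "\<not> (u n + l n) / 2 \<le> ys"
        moreover from this have "(u n + l n) / 2 < y"
          using Suc by auto
        ultimately show False using ex False by force
      qed
      then show ?thesis using step[of n] Suc False by auto
    qed
  qed
  have width: "u n - l n = (y - yt) * (1/2)^n" for n
  proof (induction n)
    case 0
    then show ?case using u0 by simp
  next
    case (Suc n)
    have "u (Suc n) - l (Suc n) = (u n - l n) / 2"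
      using step[of n] by (auto split: if_splits simp: field_simps)
    then show ?case using Suc by simp
  qed
  have "(\<lambda>n. (y - yt) * (1/2)^n) \<longlonglongrightarrow> (y - yt) * 0"
    by (intro tendsto_mult tendsto_const LIMSEQ_power_zero) simp
  then have w0: "(\<lambda>n. u n - l n) \<longlonglongrightarrow> 0"
    using width by simp
  \<comment> \<open>Squeezed between 0 and the width \<open>u n - l n\<close>.\<close>
  have "(\<lambda>n. u n - ys) \<longlonglongrightarrow> 0"
    by (rule tendsto_sandwich[OF _ _ tendsto_const w0]) (use lower upper in auto)
  then show "u \<longlonglongrightarrow> ys" by (simp add: LIM_zero_iff)
  from tendsto_diff[OF this w0] show "l \<longlonglongrightarrow> ys" by simp
qed

text \<open>A run is obtained by iterating a step function on states that selects pairs by choice;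
  the given pair starts it.\<close>

lemma bisection_run_exists:
  assumes "level_pair D f m y p q"
  shows "\<exists>u l x1 x2. bisection_run D f m y yt u l x1 x2"
proof -
  \<comment> \<open>The first point is chosen so that some partner exists, then a partner for that
    very point; two independent choices might not match.\<close>
  define step :: "real \<times> real \<times> real \<times> real \<Rightarrow> real \<times> real \<times> real \<times> real" where
    "step = (\<lambda>(u, l, a, b). let t = (u + l) / 2 in
       if \<exists>a b. level_pair D f m t a b
       then (t, l, SOME a. \<exists>b. level_pair D f m t a b,
             SOME b. level_pair D f m t (SOME a. \<exists>b. level_pair D f m t a b) b)
       else (u, t, a, b))"
  define s where "s n = (step ^^ n) (y, yt, p, q)" for n
  define u where "u n = fst (s n)" for n
  define l where "l n = fst (snd (s n))" for n
  define x1 where "x1 n = fst (snd (snd (s n)))" for n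
  define x2 where "x2 n = snd (snd (snd (s n)))" for n
  have s_eq: "s n = (u n, l n, x1 n, x2 n)" for n
    by (simp add: u_def l_def x1_def x2_def)
  have suc: "(u (Suc n), l (Suc n), x1 (Suc n), x2 (Suc n)) = step (u n, l n, x1 n, x2 n)" for n
    unfolding s_eq[symmetric] by (simp add: s_def)
  have pair: "level_pair D f m t (SOME a. \<exists>b. level_pair D f m t a b)
      (SOME b. level_pair D f m t (SOME a. \<exists>b. level_pair D f m t a b) b)"
    if "\<exists>a b. level_pair D f m t a b" for t
    using someI_ex[OF someI_ex[OF that]] .
  have "bisection_run D f m y yt u l x1 x2"
    unfolding bisection_run_def Let_def
  proof (intro conjI allI)
    show "u 0 = y" "l 0 = yt" "level_pair D f m y (x1 0) (x2 0)"
      using assms by (simp_all add: u_def l_def x1_def x2_def s_def)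
  next
    fix n
    show "if \<exists>a b. level_pair D f m ((u n + l n) / 2) a b
      then u (Suc n) = (u n + l n) / 2 \<and> l (Suc n) = l n \<and>
        level_pair D f m ((u n + l n) / 2) (x1 (Suc n)) (x2 (Suc n))
      else u (Suc n) = u n \<and> l (Suc n) = (u n + l n) / 2 \<and>
        x1 (Suc n) = x1 n \<and> x2 (Suc n) = x2 n"
      using suc[of n] pair[of "(u n + l n) / 2"]
      by (cases "\<exists>a b. level_pair D f m ((u n + l n) / 2) a b") (simp_all add: step_def Let_def)
  qed
  then show ?thesis by blast
qed

text \<open>Both points have the value \<open>u n\<close>, which tends to \<open>f m\<close>, so
  eventually they lie in a sublevel set within \<open>\<delta> / 2\<close> of \<open>m\<close>. The
  pairs come from \<open>D\<close> while convexity is known on \<open>S\<close>, hence the condition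
  on the tail.\<close>

lemma bisection_run_pairs_close:
  assumes run: "bisection_run D f m y yt u l x1 x2"
    and conv: "u \<longlonglongrightarrow> f m"
    and cvx: "strictly_convex_on S f" "m \<in> S" "\<forall>x\<in>S. f m \<le> f x"
    and ev: "\<forall>\<^sub>F n in sequentially. x1 n \<in> S \<and> x2 n \<in> S"
    and "\<delta> > 0"
  shows "\<forall>\<^sub>F n in sequentially. \<bar>x1 n - x2 n\<bar> < \<delta>"
proof -
  obtain e where e: "e > 0" "\<forall>p\<in>S. f p < f m + e \<longrightarrow> \<bar>p - m\<bar> < \<delta> / 2"
    using strictly_convex_on_sublevel_small[OF cvx, of "\<delta> / 2"] \<open>\<delta> > 0\<close> by auto
  have "\<forall>\<^sub>F n in sequentially. u n < f m + e"
    using order_tendstoD(2)[OF conv] e by simp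
  with ev show ?thesis
  proof eventually_elim
    case (elim n)
    have "f (x1 n) = u n" "f (x2 n) = u n"
      using bisection_run_level_pair[OF run, of n] by (auto simp: level_pair_def)
    then have "\<bar>x1 n - m\<bar> < \<delta> / 2" "\<bar>x2 n - m\<bar> < \<delta> / 2"
      using e elim by auto
    then show ?case by linarith
  qed
qed

text \<open>The loop stops at the least index at which its test fails.\<close>

lemma loop_exit_exists:
  assumes "\<forall>\<^sub>F n in sequentially. \<bar>x1 n - x2 n\<bar> < \<delta>"
  shows "\<exists>n. loop_exit \<delta> x1 x2 n"
proof -
  obtain n where "\<bar>x1 n - x2 n\<bar> < \<delta>"
    using assms eventually_sequentially by auto
  then have "\<not> \<bar>x2 n - x1 n\<bar> > \<delta>" by linarith
  then show ?thesis
    using exists_least_iff[of "\<lambda>n. \<not> \<bar>x2 n - x1 n\<bar> > \<delta>"] unfolding loop_exit_def by blast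
qed

section \<open>Which levels have a pair\<close>

lemma strictly_convex_on_level_pair_below:
  assumes cvx: "strictly_convex_on S f"
    and cont: "\<forall>x\<in>S - interior S. continuous (at x within S) f"
    and pair: "level_pair S f m y p q" and "f m < c" "c \<le> y"
  shows "\<exists>p q. level_pair S f m c p q"
proof -
  obtain a b where ab: "a < m" "m < b" "a \<in> S" "b \<in> S" "f a = y" "f b = y"
    using level_pair_ordered[OF pair] .
  \<comment> \<open>Convexity gives continuity at interior points, \<open>cont\<close> at the
    endpoints of \<open>S\<close>, which the pair may touch.\<close>
  have "continuous_on S f"
    unfolding continuous_on_eq_continuous_within
    using cont strictly_convex_on_continuous_on_interior[OF cvx]
    by (metis DiffI continuous_at_imp_continuous_at_within continuous_on_interior
        interior_interior)
  moreover have "{a..b} \<subseteq> S"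
    using cvx ab closed_segment_subset[of a S b]
    by (simp add: strictly_convex_on_def closed_segment_eq_real_ivl)
  ultimately show ?thesis
    using level_pair_exists[of a m b f S c] ab assms(4,5) continuous_on_subset[of S f "{a..b}"]
    by simp
qed

lemma coercive_level_pair:
  assumes cvx: "strictly_convex_on UNIV f" and "coercive_on UNIV f" "f m < y"
  shows "\<exists>p q. level_pair UNIV f m y p q"
proof -
  have lim: "filterlim f at_top at_infinity"
    using assms by (simp add: coercive_on_def)
  then have "\<forall>\<^sub>F x in at_infinity. y \<le> f x"
    by (simp add: filterlim_at_top)
  then obtain B where B: "\<And>x. B \<le> norm x \<Longrightarrow> y \<le> f x"
    by (auto simp: eventually_at_infinity)
  show ?thesis
    \<comment> \<open>Both ends have absolute value at least \<open>\<bar>B\<bar> + 1\<close>, so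
      \<open>f\<close> is at least \<open>y\<close> there.\<close>
    by (rule level_pair_exists[of "m - (\<bar>B\<bar> + \<bar>m\<bar> + 1)" m "m + (\<bar>B\<bar> + \<bar>m\<bar> + 1)"])
      (use assms B strictly_convex_on_continuous_on_interior[OF cvx] in
        \<open>auto intro: continuous_on_subset\<close>)
qed

text \<open>By uniqueness of the minimiser, \<open>f\<close> exceeds \<open>f m\<close> at both ends
  of a small interval around \<open>m\<close>; the smaller excess serves as
  \<open>\<eta>\<close>.\<close>

lemma strictly_convex_on_level_pairs_near_minimum:
  assumes cvx: "strictly_convex_on S f" and "\<forall>x\<in>S. f m \<le> f x" and "m \<in> interior S"
  shows "\<exists>\<eta>>0. \<forall>c. f m < c \<and> c < f m + \<eta> \<longrightarrow> (\<exists>p q. level_pair S f m c p q)"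
proof -
  obtain r where r: "r > 0" "cball m r \<subseteq> interior S"
    using assms open_contains_cball[of "interior S"] by auto
  then have iv: "{m - r..m + r} \<subseteq> interior S"
    by (simp add: cball_eq_atLeastAtMost)
  then have ivS: "{m - r..m + r} \<subseteq> S"
    using interior_subset by blast
  have "m \<in> S" "m - r \<in> S" "m + r \<in> S"
    using ivS r by (auto simp: subset_iff)
  then have gt: "f m < f (m - r)" "f m < f (m + r)"
    using strictly_convex_on_minimum_unique[OF cvx _ assms(2)] r by auto
  have co: "continuous_on {m - r..m + r} f"
    using strictly_convex_on_continuous_on_interior[OF cvx] iv continuous_on_subset by blast
  show ?thesis
  proof (rule exI[of _ "min (f (m - r)) (f (m + r)) - f m"], intro conjI allI impI)
    fix c assume "f m < c \<and> c < f m + (min (f (m - r)) (f (m + r)) - f m)"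
    then show "\<exists>p q. level_pair S f m c p q"
      using level_pair_exists[OF _ _ co ivS] r by auto
  qed (use gt in auto)
qed

theorem mainTheorem1:
  fixes \<Omega> :: "real set" and f :: "real \<Rightarrow> real" and xstar ystar \<epsilon> :: real
  assumes "connected \<Omega>"
    and "xstar \<in> \<Omega>" and "f xstar = ystar" and "\<forall>x\<in>\<Omega>. ystar \<le> f x"
    and "\<epsilon> > 0"
  shows
    \<comment> \<open>\<open>f\<close> strictly convex and coercive, arbitrary \<open>y > ystar\<close>. The continuity condition concerns
        only endpoints of \<open>\<Omega>\<close> that belong to \<open>\<Omega>\<close>; it is void when \<open>\<Omega>\<close> is open.\<close>
    "(strictly_convex_on \<Omega> f \<and> coercive_on \<Omega> f \<and>
      (\<forall>x\<in>\<Omega> - interior \<Omega>. continuous (at x within \<Omega>) f) \<longrightarrow>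
      (\<forall>y ytilde. ystar < y \<and> ytilde < ystar \<longrightarrow>
        (\<Omega> = UNIV \<longrightarrow> (\<exists>u l x1 x2. bisection_run \<Omega> f xstar y ytilde u l x1 x2)) \<and>
        (\<forall>u l x1 x2. bisection_run \<Omega> f xstar y ytilde u l x1 x2 \<longrightarrow>
          u \<longlonglongrightarrow> ystar \<and> l \<longlonglongrightarrow> ystar \<and>
          (\<forall>\<delta>. 0 < \<delta> \<and> \<delta> < 1 \<longrightarrow>
            (\<forall>\<^sub>F n in sequentially. \<bar>x1 n - x2 n\<bar> < \<delta>) \<and>
            (\<exists>n. loop_exit \<delta> x1 x2 n)))))
     \<and>
     \<comment> \<open>\<open>f\<close> strictly convex only in a neighbourhood \<open>N\<close> of \<open>xstar\<close> in \<open>\<Omega>\<close>, \<open>y\<close> close to \<open>ystar\<close>.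
        The pairs may be looked for in \<open>N\<close> or in a larger set \<open>D\<close>; they get close to each other
        once they lie in \<open>N\<close>, which is automatic for \<open>D = N\<close>.\<close>
     (\<forall>N. openin (top_of_set \<Omega>) N \<and> xstar \<in> N \<and> strictly_convex_on N f \<longrightarrow>
      (\<exists>\<eta>>0. \<forall>y ytilde. ystar < y \<and> y < ystar + \<eta> \<and> ytilde < ystar \<longrightarrow>
        (xstar \<in> interior \<Omega> \<longrightarrow> (\<exists>u l x1 x2. bisection_run N f xstar y ytilde u l x1 x2)) \<and>
        (\<forall>D u l x1 x2. N \<subseteq> D \<and> D \<subseteq> \<Omega> \<and> bisection_run D f xstar y ytilde u l x1 x2 \<longrightarrow>
          u \<longlonglongrightarrow> ystar \<and> l \<longlonglongrightarrow> ystar \<and>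
          ((\<forall>\<^sub>F n in sequentially. x1 n \<in> N \<and> x2 n \<in> N) \<longrightarrow>
           (\<forall>\<delta>. 0 < \<delta> \<and> \<delta> < 1 \<longrightarrow>
             (\<forall>\<^sub>F n in sequentially. \<bar>x1 n - x2 n\<bar> < \<delta>) \<and>
             (\<exists>n. loop_exit \<delta> x1 x2 n))))))"
proof (rule conjI)
  have conv: "convex \<Omega>"
    using \<open>connected \<Omega>\<close> is_interval_connected_1 is_interval_convex_1 by blast
  have min: "\<forall>x\<in>\<Omega>. f xstar \<le> f x"
    using assms by simp
  show "strictly_convex_on \<Omega> f \<and> coercive_on \<Omega> f \<and>
      (\<forall>x\<in>\<Omega> - interior \<Omega>. continuous (at x within \<Omega>) f) \<longrightarrow>
      (\<forall>y ytilde. ystar < y \<and> ytilde < ystar \<longrightarrow>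
        (\<Omega> = UNIV \<longrightarrow> (\<exists>u l x1 x2. bisection_run \<Omega> f xstar y ytilde u l x1 x2)) \<and>
        (\<forall>u l x1 x2. bisection_run \<Omega> f xstar y ytilde u l x1 x2 \<longrightarrow>
          u \<longlonglongrightarrow> ystar \<and> l \<longlonglongrightarrow> ystar \<and>
          (\<forall>\<delta>. 0 < \<delta> \<and> \<delta> < 1 \<longrightarrow>
            (\<forall>\<^sub>F n in sequentially. \<bar>x1 n - x2 n\<bar> < \<delta>) \<and>
            (\<exists>n. loop_exit \<delta> x1 x2 n))))"
  proof (intro impI allI, elim conjE, rule conjI; (intro impI allI)?)
    fix y ytilde
    assume cvx: "strictly_convex_on \<Omega> f" and coe: "coercive_on \<Omega> f"
      and y: "ystar < y" and "\<Omega> = UNIV"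
    then show "\<exists>u l x1 x2. bisection_run \<Omega> f xstar y ytilde u l x1 x2"
      using coercive_level_pair[of f xstar y] bisection_run_exists assms(3) by blast
  next
    fix y ytilde u l x1 x2
    assume cvx: "strictly_convex_on \<Omega> f"
      and cont: "\<forall>x\<in>\<Omega> - interior \<Omega>. continuous (at x within \<Omega>) f"
      and yt: "ytilde < ystar"
      and run: "bisection_run \<Omega> f xstar y ytilde u l x1 x2"
    have pair0: "level_pair \<Omega> f xstar y (x1 0) (x2 0)"
      using run by (simp add: bisection_run_def)
    \<comment> \<open>The run itself carries a pair at the level \<open>y\<close>, from which the
      lower levels above \<open>ystar\<close> get theirs.\<close>
    have ex: "\<exists>p q. level_pair \<Omega> f xstar c p q" if "ystar < c" "c < y" for c
      using strictly_convex_on_level_pair_below[OF cvx cont pair0] that assms(3) by simp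
    note lim = bisection_run_tendsto[OF run assms(4) ex yt]
    have mem: "\<forall>\<^sub>F n in sequentially. x1 n \<in> \<Omega> \<and> x2 n \<in> \<Omega>"
      using bisection_run_level_pair[OF run] by (auto simp: level_pair_def)
    have "\<forall>\<^sub>F n in sequentially. \<bar>x1 n - x2 n\<bar> < \<delta>" if "0 < \<delta>" for \<delta>
      using bisection_run_pairs_close[OF run _ cvx \<open>xstar \<in> \<Omega>\<close> min mem that] lim(1) assms(3)
      by blast
    then show "u \<longlonglongrightarrow> ystar \<and> l \<longlonglongrightarrow> ystar \<and>
      (\<forall>\<delta>. 0 < \<delta> \<and> \<delta> < 1 \<longrightarrow>
        (\<forall>\<^sub>F n in sequentially. \<bar>x1 n - x2 n\<bar> < \<delta>) \<and> (\<exists>n. loop_exit \<delta> x1 x2 n))"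
      using lim loop_exit_exists by blast
  qed
  show "\<forall>N. openin (top_of_set \<Omega>) N \<and> xstar \<in> N \<and> strictly_convex_on N f \<longrightarrow>
      (\<exists>\<eta>>0. \<forall>y ytilde. ystar < y \<and> y < ystar + \<eta> \<and> ytilde < ystar \<longrightarrow>
        (xstar \<in> interior \<Omega> \<longrightarrow> (\<exists>u l x1 x2. bisection_run N f xstar y ytilde u l x1 x2)) \<and>
        (\<forall>D u l x1 x2. N \<subseteq> D \<and> D \<subseteq> \<Omega> \<and> bisection_run D f xstar y ytilde u l x1 x2 \<longrightarrow>
          u \<longlonglongrightarrow> ystar \<and> l \<longlonglongrightarrow> ystar \<and>
          ((\<forall>\<^sub>F n in sequentially. x1 n \<in> N \<and> x2 n \<in> N) \<longrightarrow>
           (\<forall>\<delta>. 0 < \<delta> \<and> \<delta> < 1 \<longrightarrow>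
             (\<forall>\<^sub>F n in sequentially. \<bar>x1 n - x2 n\<bar> < \<delta>) \<and>
             (\<exists>n. loop_exit \<delta> x1 x2 n)))))"
  proof (intro allI impI, elim conjE)
    fix N
    assume op: "openin (top_of_set \<Omega>) N" and xN: "xstar \<in> N" and cvx: "strictly_convex_on N f"
    have N\<Omega>: "N \<subseteq> \<Omega>" using op openin_imp_subset by blast
    then have minN: "\<forall>x\<in>N. f xstar \<le> f x" using min by blast
    have int: "xstar \<in> interior N" if "xstar \<in> interior \<Omega>"
    proof -
      obtain T where T: "open T" "N = \<Omega> \<inter> T"
        using op openin_open by metis
      then show ?thesis
        using that xN by (simp add: interior_open)
    qed
    \<comment> \<open>One \<open>\<eta>\<close> has to be fixed before any run is given. If
      \<open>xstar\<close> is an endpoint of \<open>\<Omega>\<close>, the implication is vacuous and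
      1 is a dummy value.\<close>
    have "\<exists>\<eta>>0. xstar \<in> interior \<Omega> \<longrightarrow>
        (\<forall>c. f xstar < c \<and> c < f xstar + \<eta> \<longrightarrow> (\<exists>p q. level_pair N f xstar c p q))"
      using strictly_convex_on_level_pairs_near_minimum[OF cvx minN] int
      by (cases "xstar \<in> interior \<Omega>") (auto intro: exI[of _ 1])
    then obtain \<eta> where "\<eta> > 0" and
      pairs: "\<And>c. xstar \<in> interior \<Omega> \<Longrightarrow> ystar < c \<Longrightarrow> c < ystar + \<eta> \<Longrightarrow>
        \<exists>p q. level_pair N f xstar c p q"
      using assms(3) by blast
    show "\<exists>\<eta>>0. \<forall>y ytilde. ystar < y \<and> y < ystar + \<eta> \<and> ytilde < ystar \<longrightarrow>
        (xstar \<in> interior \<Omega> \<longrightarrow> (\<exists>u l x1 x2. bisection_run N f xstar y ytilde u l x1 x2)) \<and>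
        (\<forall>D u l x1 x2. N \<subseteq> D \<and> D \<subseteq> \<Omega> \<and> bisection_run D f xstar y ytilde u l x1 x2 \<longrightarrow>
          u \<longlonglongrightarrow> ystar \<and> l \<longlonglongrightarrow> ystar \<and>
          ((\<forall>\<^sub>F n in sequentially. x1 n \<in> N \<and> x2 n \<in> N) \<longrightarrow>
           (\<forall>\<delta>. 0 < \<delta> \<and> \<delta> < 1 \<longrightarrow>
             (\<forall>\<^sub>F n in sequentially. \<bar>x1 n - x2 n\<bar> < \<delta>) \<and>
             (\<exists>n. loop_exit \<delta> x1 x2 n))))"
    proof (rule exI[of _ \<eta>], rule conjI[OF \<open>\<eta> > 0\<close>], intro allI impI, elim conjE,
        rule conjI; (intro allI impI)?, (elim conjE)?)
      fix y ytilde
      assume "ystar < y" "y < ystar + \<eta>" "xstar \<in> interior \<Omega>"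
      then show "\<exists>u l x1 x2. bisection_run N f xstar y ytilde u l x1 x2"
        using pairs bisection_run_exists by blast
    next
      fix y ytilde D u l x1 x2
      assume y: "y < ystar + \<eta>" and yt: "ytilde < ystar"
        and D: "N \<subseteq> D" "D \<subseteq> \<Omega>"
        and run: "bisection_run D f xstar y ytilde u l x1 x2"
      \<comment> \<open>The pair carried by the run surrounds \<open>xstar\<close>, which makes
        \<open>pairs\<close> applicable; the pairs found in \<open>N\<close> also count in
        \<open>D\<close>.\<close>
      have "xstar \<in> interior \<Omega>"
        using level_pair_interior[OF bisection_run_level_pair[OF run] D(2) conv] .
      then have "\<exists>p q. level_pair N f xstar c p q" if "ystar < c" "c < y" for c
        using pairs that y by simp
      then have ex: "\<exists>p q. level_pair D f xstar c p q" if "ystar < c" "c < y" for c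
        using that D(1) unfolding level_pair_def by blast
      have "\<forall>x\<in>D. ystar \<le> f x" using assms(4) D(2) by blast
      note lim = bisection_run_tendsto[OF run this ex yt]
      have "\<forall>\<^sub>F n in sequentially. \<bar>x1 n - x2 n\<bar> < \<delta>"
        if "\<forall>\<^sub>F n in sequentially. x1 n \<in> N \<and> x2 n \<in> N" "0 < \<delta>" for \<delta>
        using bisection_run_pairs_close[OF run _ cvx xN minN that] lim(1) assms(3) by blast
      then show "u \<longlonglongrightarrow> ystar \<and> l \<longlonglongrightarrow> ystar \<and>
          ((\<forall>\<^sub>F n in sequentially. x1 n \<in> N \<and> x2 n \<in> N) \<longrightarrow>
           (\<forall>\<delta>. 0 < \<delta> \<and> \<delta> < 1 \<longrightarrow>
             (\<forall>\<^sub>F n in sequentially. \<bar>x1 n - x2 n\<bar> < \<delta>) \<and>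
             (\<exists>n. loop_exit \<delta> x1 x2 n)))"
        using lim loop_exit_exists by blast
    qed
  qed
qed

end
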